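(* Let $U$ and $U_n$, $n\in\mathbb{N}$, be simply connected domains in $\mathbb{C}$ and let $F_n:U\to U_n$, $n\in\mathbb{N}$, be a sequence of holomorphic maps. If there exists $z_0\in U$ such that \[ \operatorname{dist}(F_n(z_0),\partial U_n)\to 0\quad\text{as } n\to\infty, \] then, for all $z\in U$, \[ |F_n(z)-F_n(z_0)|\to 0\quad\text{as } n\to\infty. \]
   Context: Simply connected domains are always assumed to be proper subsets of $\mathbb{C}$ (not necessarily distinct). $\operatorname{dist}(\cdot,\cdot)$ denotes Euclidean distance. The maps $F_n$ need not be surjective. *)

theory Defs
  imports "HOL-Complex_Analysis.Complex_Analysis"
begin

(* Simply connected domains exclude the whole plane. Since simply_connected {} holds in the
   library, nonemptiness is required explicitly; connectedness follows from simply_connected.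
   The frontier of such a domain is then nonempty, so infdist to it is the genuine distance. *)
definition simply_connected_domain :: "complex set \<Rightarrow> bool" where
  "simply_connected_domain U \<longleftrightarrow>
     open U \<and> U \<noteq> {} \<and> simply_connected U \<and> U \<noteq> UNIV"

end

theory Submission
  imports Defs
begin

text \<open>
  Let \<open>p\<close> be a point of \<open>\<partial>U\<^sub>n\<close> nearest to \<open>F\<^sub>n(z\<^sub>0)\<close>. As \<open>U\<^sub>n\<close> is simply connected, there is a branch
  \<open>L\<close> of \<open>log(w - p)\<close> on \<open>U\<^sub>n\<close>. Two values of \<open>L\<close> never differ by a nonzero multiple of \<open>2\<pi>i\<close>, so
  the functions \<open>(L(F\<^sub>n(z)) - L(F\<^sub>n(z\<^sub>0))) / 2\<pi>i\<close> omit \<open>1\<close> and \<open>-1\<close> and vanish at \<open>z\<^sub>0\<close>. By Schottky's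
  theorem they are bounded at each \<open>z\<close> uniformly in \<open>n\<close>. Hence \<open>|F\<^sub>n(z) - p| \<le> C(z) |F\<^sub>n(z\<^sub>0) - p|\<close>.
\<close>

text \<open>This is a form of Schottky's theorem, reduced to \<open>GPicard3\<close>, which gives
  one bound for a whole family that omits \<open>0\<close> and \<open>1\<close> and is bounded by
  \<open>1\<close> at \<open>w\<close>.\<close>

lemma omits_pm1_bounded_pointwise:
  assumes S: "open S" "connected S" "w \<in> S" "z \<in> S"
    and hol: "\<And>g. g \<in> G \<Longrightarrow> g holomorphic_on S"
    and omit: "\<And>g u. g \<in> G \<Longrightarrow> u \<in> S \<Longrightarrow> g u \<noteq> 1 \<and> g u \<noteq> - 1"
    and zero: "\<And>g. g \<in> G \<Longrightarrow> g w = 0"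
  obtains B :: real where "\<And>g. g \<in> G \<Longrightarrow> norm (g z) \<le> B"
proof -
  \<comment> \<open>The affine map moves the omitted values \<open>-1\<close> and \<open>1\<close>
    to \<open>0\<close> and \<open>1\<close>, and the common value \<open>0\<close> at
    \<open>w\<close> to \<open>1/2\<close>.\<close>
  define Y where "Y = (\<lambda>g u. (g u + 1) / 2) ` G"
  obtain B where B: "\<And>h u. \<lbrakk>h \<in> Y; u \<in> {z}\<rbrakk> \<Longrightarrow> norm (h u) \<le> B"
  proof (rule GPicard3 [OF S(1-3) order_refl [of Y], where K = "{z}"])
    show "h holomorphic_on S" if "h \<in> Y" for h
      using that by (auto simp: Y_def intro!: holomorphic_intros dest: hol)
    show "h u \<noteq> 0 \<and> h u \<noteq> 1" if "h \<in> Y" "u \<in> S" for h u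
      using that omit by (auto simp: Y_def add_eq_0_iff2)
    show "norm (h w) \<le> 1" if "h \<in> Y" for h
      using that by (auto simp: Y_def zero)
  qed (use \<open>z \<in> S\<close> in auto)
  show thesis
  proof
    fix g assume "g \<in> G"
    then have "(\<lambda>u. (g u + 1) / 2) \<in> Y"
      unfolding Y_def by (rule imageI)
    from B [OF this, of z] have "norm ((g z + 1) / 2) \<le> B"
      by simp
    moreover have "norm (g z) \<le> norm (g z + 1) + 1"
      using norm_triangle_ineq4 [of "g z + 1" 1] by simp
    ultimately show "norm (g z) \<le> 2 * B + 1"
      by (simp add: norm_divide)
  qed
qed

text \<open>Here \<open>g\<close> is the change from \<open>f w\<close> of a logarithm of
  \<open>f - p\<close>, in units of \<open>2 * pi * \<i>\<close>. The branch must live on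
  \<open>V\<close>, not merely on \<open>U\<close>: this is what excludes the values
  \<open>1\<close> and \<open>-1\<close>.\<close>

lemma holomorphic_log_omits_pm1:
  assumes V: "open V" "simply_connected V" "p \<notin> V"
    and f: "f holomorphic_on U" "f ` U \<subseteq> V" and w: "w \<in> U"
  obtains g where "g holomorphic_on U" "g w = 0"
    "\<And>z. z \<in> U \<Longrightarrow> g z \<noteq> 1 \<and> g z \<noteq> - 1"
    "\<And>z. z \<in> U \<Longrightarrow> f z - p = (f w - p) * exp (2 * of_real pi * \<i> * g z)"
proof -
  have "(\<lambda>x. x - p) holomorphic_on V" "\<forall>x\<in>V. x - p \<noteq> 0"
    using \<open>p \<notin> V\<close> by (auto intro!: holomorphic_intros)
  then obtain L where L: "L holomorphic_on V" and exp_L: "\<And>x. x \<in> V \<Longrightarrow> x - p = exp (L x)"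
    using simply_connected_eq_holomorphic_log [OF \<open>open V\<close>] \<open>simply_connected V\<close> by metis
  define g where "g z = (L (f z) - L (f w)) / (2 * of_real pi * \<i>)" for z
  have Lf: "L (f z) = L (f w) + 2 * of_real pi * \<i> * g z" for z
    by (simp add: g_def)
  have eq: "f z - p = (f w - p) * exp (2 * of_real pi * \<i> * g z)" if "z \<in> U" for z
  proof -
    have "f z - p = exp (L (f z))" "f w - p = exp (L (f w))"
      using exp_L f w that by auto
    then show ?thesis
      by (simp add: Lf [of z] exp_add)
  qed
  show thesis
  proof
    have "(L \<circ> f) holomorphic_on U"
      using f(1) L f(2) by (rule holomorphic_on_compose_gen)
    then show "g holomorphic_on U"
      unfolding g_def [abs_def] o_def by (auto intro!: holomorphic_intros)
    show "g w = 0"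
      by (simp add: g_def)
    show "g z \<noteq> 1 \<and> g z \<noteq> - 1" if z: "z \<in> U" for z
    proof (rule ccontr)
      assume "\<not> ?thesis"
      then have *: "g z = 1 \<or> g z = - 1"
        by blast
      then have "exp (2 * of_real pi * \<i> * g z) = 1"
        by (auto simp: exp_minus)
      \<comment> \<open>The branch \<open>L\<close> is single-valued on \<open>V\<close>, so equal
        values of \<open>f\<close> force \<open>g z = 0\<close>.\<close>
      with eq [OF z] have "f z = f w"
        by simp
      then have "g z = 0"
        by (simp add: g_def)
      with * show False
        by auto
    qed
  qed (fact eq)
qed

theorem theoremA:
  fixes U :: "complex set"
    and V :: "nat \<Rightarrow> complex set"
    and F :: "nat \<Rightarrow> complex \<Rightarrow> complex"
    and z\<^sub>0 :: complex
  assumes "simply_connected_domain U"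
    and "\<And>n. simply_connected_domain (V n)"
    and "\<And>n. F n holomorphic_on U"
    and "\<And>n. F n ` U \<subseteq> V n"
    and "z\<^sub>0 \<in> U"
    and "(\<lambda>n. infdist (F n z\<^sub>0) (frontier (V n))) \<longlonglongrightarrow> 0"
  shows "\<forall>z\<in>U. (\<lambda>n. norm (F n z - F n z\<^sub>0)) \<longlonglongrightarrow> 0"
proof
  fix z assume z: "z \<in> U"
  have U: "open U" "connected U"
    using assms(1) by (auto simp: simply_connected_domain_def simply_connected_imp_connected)
  \<comment> \<open>Only the empty set and the whole plane have empty frontier, so a nearest
    frontier point exists.\<close>
  have V: "open (V n)" "simply_connected (V n)" "frontier (V n) \<noteq> {}" for n
    using assms(2) [of n] by (auto simp: simply_connected_domain_def frontier_eq_empty)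
  define d where "d n = infdist (F n z\<^sub>0) (frontier (V n))" for n
  have "\<exists>p\<in>frontier (V n). d n = dist (F n z\<^sub>0) p" for n
    unfolding d_def using infdist_attains_inf [OF frontier_closed V(3)] by metis
  then obtain p where p: "\<And>n. p n \<in> frontier (V n)" "\<And>n. d n = norm (F n z\<^sub>0 - p n)"
    unfolding dist_norm by metis
  have "p n \<notin> V n" for n
    using p(1) [of n] V(1) [of n] by (simp add: frontier_def interior_open)
  then have "\<exists>g. g holomorphic_on U \<and> g z\<^sub>0 = 0 \<and> (\<forall>u\<in>U. g u \<noteq> 1 \<and> g u \<noteq> - 1) \<and>
      (\<forall>u\<in>U. F n u - p n = (F n z\<^sub>0 - p n) * exp (2 * of_real pi * \<i> * g u))" for n
    using holomorphic_log_omits_pm1 [OF V(1,2) _ assms(3,4,5)] by metis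
  then obtain g where g: "\<And>n. g n holomorphic_on U" "\<And>n. g n z\<^sub>0 = 0"
      "\<And>n u. u \<in> U \<Longrightarrow> g n u \<noteq> 1 \<and> g n u \<noteq> - 1"
      "\<And>n u. u \<in> U \<Longrightarrow> F n u - p n = (F n z\<^sub>0 - p n) * exp (2 * of_real pi * \<i> * g n u)"
    by metis
  \<comment> \<open>Treating all \<open>g n\<close> as one family makes \<open>B\<close> independent
    of \<open>n\<close>; it may depend on \<open>z\<close>.\<close>
  obtain B where B: "\<And>n. norm (g n z) \<le> B"
    by (rule omits_pm1_bounded_pointwise [OF U assms(5) z, of "range g"]) (use g in auto)
  have bound: "norm (F n z - F n z\<^sub>0) \<le> d n * (exp (2 * pi * B) + 1)" for n
  proof -
    let ?e = "exp (2 * of_real pi * \<i> * g n z)"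
    have "norm ?e \<le> exp (norm (2 * of_real pi * \<i> * g n z))"
      by (rule norm_exp)
    also have "\<dots> \<le> exp (2 * pi * B)"
      using B [of n] by (simp add: norm_mult)
    finally have "norm (?e - 1) \<le> exp (2 * pi * B) + 1"
      using norm_triangle_ineq4 [of ?e 1] unfolding norm_one by linarith
    \<comment> \<open>The first factor has norm \<open>d n\<close>, which tends to 0; the second is
      bounded uniformly in \<open>n\<close>.\<close>
    moreover have "F n z - F n z\<^sub>0 = (F n z\<^sub>0 - p n) * (?e - 1)"
      using g(4) [OF z, of n] by (simp add: algebra_simps)
    ultimately show ?thesis
      by (simp add: norm_mult p(2) mult_left_mono)
  qed
  show "(\<lambda>n. norm (F n z - F n z\<^sub>0)) \<longlonglongrightarrow> 0"
  proof (rule tendsto_sandwich [OF _ _ tendsto_const])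
    show "(\<lambda>n. d n * (exp (2 * pi * B) + 1)) \<longlonglongrightarrow> 0"
      using assms(6) unfolding d_def by (rule tendsto_mult_left_zero)
  qed (use bound in auto)
qed

end
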